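(* Let $A$ be a compact metric space without isolated points, $f:A\to A$ a continuous map, and $\mu$ a Borel probability measure on $A$ with full support such that $(A,\mu,f)$ is ergodic. Let $h:A\to\mathbb{C}$ be a continuous function with $\gamma=\int_A\log|h|\,d\mu$ finite. Let $X$ be an infinite dimensional separable complex Banach space, $T$ a bounded linear operator on $X$, and let $P:A\times X\to A\times X$ be the skew product $P(a,x)=(f(a),h(a)Tx)$. Suppose that $(A\times X,P)$ is (topologically) weakly mixing and that the set $\{(a,b)\in A\times A:(a,x,b,y)\in\mathrm{Trans}_{P\times P}\text{ for some }x,y\in X\}$ has positive measure with respect to the product measure $\mu\times\mu$. Then there exist an increasing sequence of positive integers $(n_k)$, two dense subsets $D_1,D_2$ of $X$ and a sequence of mappings $S_{n_k}:D_2\to X$ such that (i) $\limsup_k\|T^{n_k}x\|^{1/n_k}\le e^{-\gamma}$ for every $x\in D_1$; (ii) $\limsup_k\|S_{n_k}y\|^{1/n_k}\le e^{\gamma}$ for every $y\in D_2$; (iii) $\|T^{n_k}S_{n_k}y-y\|\to0$ as $k\to\infty$ for every $y\in D_2$.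
   Context: A continuous self-map $S$ of a space $Y$ is topologically transitive if for all nonempty open $U,V\subset Y$ there is an integer $n\ge1$ with $S^n(U)\cap V\ne\emptyset$; $(Y,S)$ is topologically weakly mixing if $S\times S$ on $Y\times Y$ is topologically transitive. $\mathrm{Trans}_S$ is the set of transitive points, i.e. points $y$ with $\{S^ny:n\ge0\}$ dense in $Y$. Here $P\times P$ acts on $(A\times X)\times(A\times X)$. $(A,\mu,f)$ ergodic means that $f$ preserves $\mu$ and every Borel set $\Gamma$ with $f^{-1}(\Gamma)=\Gamma$ has measure $0$ or $1$; full support means $\mu(U)>0$ for every nonempty open $U$. The maps $S_{n_k}$ are arbitrary maps. *)

theory Defs
  imports "HOL-Probability.Probability"
begin

class complex_normed_vector = real_normed_vector +
  fixes scaleC :: "complex \<Rightarrow> 'a \<Rightarrow> 'a"  (infixr "*\<^sub>C" 75)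
  assumes scaleC_add_right: "c *\<^sub>C (x + y) = c *\<^sub>C x + c *\<^sub>C y"
    and scaleC_add_left: "(c + d) *\<^sub>C x = c *\<^sub>C x + d *\<^sub>C x"
    and scaleC_scaleC: "c *\<^sub>C d *\<^sub>C x = (c * d) *\<^sub>C x"
    and scaleC_one: "1 *\<^sub>C x = x"
    and scaleC_of_real: "complex_of_real r *\<^sub>C x = r *\<^sub>R x"
    and norm_scaleC: "norm (c *\<^sub>C x) = cmod c * norm x"

class complex_banach = complex_normed_vector + banach

lemma vector_space_scaleC:
  "vector_space (scaleC :: complex \<Rightarrow> 'a \<Rightarrow> 'a::complex_normed_vector)"
  by unfold_locales (simp_all add: scaleC_add_right scaleC_add_left scaleC_scaleC scaleC_one)

instantiation complex :: complex_banach
begin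

definition scaleC_complex :: "complex \<Rightarrow> complex \<Rightarrow> complex"
  where "scaleC_complex c x = c * x"

instance
  by standard
    (simp_all add: scaleC_complex_def distrib_left distrib_right mult.assoc norm_mult
      scaleR_conv_of_real)

end

definition infinite_dimensional :: "'a::complex_normed_vector itself \<Rightarrow> bool" where
  "infinite_dimensional _ \<longleftrightarrow>
     \<not> (\<exists>B :: 'a set. finite B \<and> module.span scaleC B = UNIV)"

definition bounded_clinear ::
    "('a::complex_normed_vector \<Rightarrow> 'b::complex_normed_vector) \<Rightarrow> bool" where
  "bounded_clinear T \<longleftrightarrow>
     Vector_Spaces.linear scaleC scaleC T \<and> (\<exists>K. \<forall>x. norm (T x) \<le> K * norm x)"

definition topologically_transitive :: "('a::topological_space \<Rightarrow> 'a) \<Rightarrow> bool" where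
  "topologically_transitive S \<longleftrightarrow>
     (\<forall>U V. open U \<and> U \<noteq> {} \<and> open V \<and> V \<noteq> {} \<longrightarrow>
        (\<exists>n\<ge>1. (S ^^ n) ` U \<inter> V \<noteq> {}))"

definition topologically_weakly_mixing :: "('a::topological_space \<Rightarrow> 'a) \<Rightarrow> bool" where
  "topologically_weakly_mixing S \<longleftrightarrow> topologically_transitive (map_prod S S)"

definition Trans :: "('a::topological_space \<Rightarrow> 'a) \<Rightarrow> 'a set" where
  "Trans S = {y. closure (range (\<lambda>n. (S ^^ n) y)) = UNIV}"

definition skew_product ::
    "('a \<Rightarrow> 'a) \<Rightarrow> ('a \<Rightarrow> complex) \<Rightarrow> ('x \<Rightarrow> 'x) \<Rightarrow> 'a \<times> 'x \<Rightarrow> 'a \<times> 'x::complex_normed_vector"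
  where "skew_product f h T = (\<lambda>(a, x). (f a, h a *\<^sub>C T x))"

definition borel_probability :: "'a::topological_space measure \<Rightarrow> bool" where
  "borel_probability \<mu> \<longleftrightarrow> prob_space \<mu> \<and> sets \<mu> = sets borel"

definition full_support :: "'a::topological_space measure \<Rightarrow> bool" where
  "full_support \<mu> \<longleftrightarrow> (\<forall>U. open U \<and> U \<noteq> {} \<longrightarrow> emeasure \<mu> U > 0)"

definition ergodic :: "'a::topological_space measure \<Rightarrow> ('a \<Rightarrow> 'a) \<Rightarrow> bool" where
  "ergodic \<mu> f \<longleftrightarrow>
     f \<in> measurable \<mu> \<mu> \<and> distr \<mu> \<mu> f = \<mu> \<and>
     (\<forall>\<Gamma> \<in> sets borel. f -` \<Gamma> = \<Gamma> \<longrightarrow> emeasure \<mu> \<Gamma> = 0 \<or> emeasure \<mu> \<Gamma> = 1)"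

text \<open>The integral of \<open>log |h|\<close>, where \<open>log 0 = -\<infinity>\<close>, is finite. Since \<open>ln 0 = 0\<close> for the
  library logarithm, the condition that \<open>h\<close> vanishes only on a null set must be stated
  separately; under it the extended-valued integral is the Bochner integral of
  \<open>ln (cmod (h a))\<close>.\<close>

definition finite_log_integral :: "'a measure \<Rightarrow> ('a \<Rightarrow> complex) \<Rightarrow> bool" where
  "finite_log_integral \<mu> h \<longleftrightarrow>
     (AE a in \<mu>. h a \<noteq> 0) \<and> integrable \<mu> (\<lambda>a. ln (cmod (h a)))"

text \<open>Base points of transitive points of \<open>P \<times> P\<close>. This set is a projection of a
  \<open>G\<^sub>\<delta>\<close> set, so it is analytic but not necessarily Borel; its measure is therefore to be
  taken with respect to the completion of \<open>\<mu> \<times> \<mu>\<close>.\<close>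

definition transitive_base :: "('a::topological_space \<times> 'x::topological_space \<Rightarrow> 'a \<times> 'x) \<Rightarrow> ('a \<times> 'a) set"
  where "transitive_base P = {(a, b). \<exists>x y. ((a, x), (b, y)) \<in> Trans (map_prod P P)}"

end

theory Submission
  imports Defs
begin

text \<open>By Birkhoff's theorem \<open>\<bar>h a \<cdots> h (f\<^sup>n\<^sup>-\<^sup>1 a)\<bar>\<close> grows like \<open>exp (n \<gamma>)\<close> for almost all \<open>a\<close>. Hence
  there is a transitive point \<open>((a, x), (b, y))\<close> of \<open>P \<times> P\<close> with both \<open>a\<close> and \<open>b\<close> generic in this
  sense. Write \<open>h\<^sub>n\<close> for the cocycle. Along times \<open>n\<^sub>k\<close> at which \<open>h\<^sub>n(a) T\<^sup>n x\<close> is bounded and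
  \<open>h\<^sub>n(b) T\<^sup>n y\<close> tends to \<open>x\<close>, the vectors \<open>T\<^sup>n x\<close> are at most of order \<open>exp (- n \<gamma>)\<close>, and
  \<open>u\<^sub>n = h\<^sub>n(b) y\<close> is of order \<open>exp (n \<gamma>)\<close> with \<open>T\<^sup>n u\<^sub>n \<rightarrow> x\<close>. Everything commutes with \<open>T\<close>, so
  \<open>D\<^sub>1 = D\<^sub>2 = {h\<^sub>m(a) T\<^sup>m x}\<close> and \<open>S\<^sub>n (h\<^sub>m(a) T\<^sup>m x) = h\<^sub>m(a) T\<^sup>m u\<^sub>n\<close> work.\<close>

section \<open>Birkhoff sums\<close>

definition birkhoff_sum :: "('a \<Rightarrow> 'a) \<Rightarrow> ('a \<Rightarrow> real) \<Rightarrow> nat \<Rightarrow> 'a \<Rightarrow> real" where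
  "birkhoff_sum f g n a = (\<Sum>j<n. g ((f ^^ j) a))"

lemma birkhoff_sum_Suc: "birkhoff_sum f g (Suc n) a = g a + birkhoff_sum f g n (f a)"
  unfolding birkhoff_sum_def sum.lessThan_Suc_shift by (simp add: funpow_swap1)

lemma birkhoff_sum_diff_const:
  "birkhoff_sum f (\<lambda>a. g a - c) n a = birkhoff_sum f g n a - c * real n"
  by (simp add: birkhoff_sum_def sum_subtractf)

lemma birkhoff_sum_uminus: "birkhoff_sum f (\<lambda>a. - g a) n a = - birkhoff_sum f g n a"
  by (simp add: birkhoff_sum_def sum_negf)

lemma measurable_funpow [measurable]:
  assumes "f \<in> measurable M M" shows "f ^^ n \<in> measurable M M"
  by (induction n) (use assms in \<open>auto simp: id_def intro: measurable_comp\<close>)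

lemma borel_measurable_birkhoff_sum [measurable]:
  assumes [measurable]: "f \<in> measurable M M" "g \<in> borel_measurable M"
  shows "birkhoff_sum f g n \<in> borel_measurable M"
  unfolding birkhoff_sum_def [abs_def] by measurable

text \<open>The maximum of the Birkhoff sums of length at most \<open>n\<close>, including the empty one.\<close>

primrec max_birkhoff :: "('a \<Rightarrow> 'a) \<Rightarrow> ('a \<Rightarrow> real) \<Rightarrow> nat \<Rightarrow> 'a \<Rightarrow> real" where
  "max_birkhoff f g 0 a = 0"
| "max_birkhoff f g (Suc n) a = max 0 (g a + max_birkhoff f g n (f a))"

lemma birkhoff_sum_le_max: "birkhoff_sum f g n a \<le> max_birkhoff f g n a"
proof (induction n arbitrary: a)
  case 0
  then show ?case by (simp add: birkhoff_sum_def)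
next
  case (Suc n)
  show ?case using Suc[of "f a"] by (simp add: birkhoff_sum_Suc)
qed

lemma max_birkhoff_nonneg: "0 \<le> max_birkhoff f g n a"
  by (cases n) auto

lemma max_birkhoff_mono_Suc: "max_birkhoff f g n a \<le> max_birkhoff f g (Suc n) a"
proof (induction n arbitrary: a)
  case (Suc n)
  show ?case using Suc[of "f a"] by auto
qed simp

lemma max_birkhoff_mono: "m \<le> n \<Longrightarrow> max_birkhoff f g m a \<le> max_birkhoff f g n a"
  by (rule lift_Suc_mono_le[of "\<lambda>n. max_birkhoff f g n a"]) (rule max_birkhoff_mono_Suc)

section \<open>The maximal ergodic inequality\<close>

lemma measure_preserving_integral:
  fixes g :: "'a \<Rightarrow> real"
  assumes "f \<in> measurable M M" "distr M M f = M" "integrable M g"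
  shows "integrable M (\<lambda>a. g (f a))" "(\<integral>a. g (f a) \<partial>M) = (\<integral>a. g a \<partial>M)"
  using integrable_distr_eq[of f M M g] integral_distr[of f M M g] assms
  by (auto simp: borel_measurable_integrable)

lemma integrable_max_birkhoff:
  assumes "f \<in> measurable M M" "distr M M f = M" "integrable M g"
  shows "integrable M (max_birkhoff f g n)"
proof (induction n)
  case 0
  then show ?case by (simp add: max_birkhoff.simps(1)[abs_def] cong: integrable_cong)
next
  case (Suc n)
  have "integrable M (\<lambda>a. max 0 (g a + max_birkhoff f g n (f a)))"
    using measure_preserving_integral(1)[OF assms(1,2) Suc] assms(3)
    by (intro integrable_max) auto
  then show ?case by (simp cong: integrable_cong)
qed

text \<open>Garsia's argument: cutting \<open>g\<close> off to the set where
  \<open>max_birkhoff f g (Suc n)\<close> is positive gives a function that dominates this maximum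
  minus its composition with \<open>f\<close>. That difference has integral zero, because
  \<open>f\<close> preserves \<open>M\<close>.\<close>

lemma maximal_ergodic:
  fixes g :: "'a \<Rightarrow> real"
  assumes f: "f \<in> measurable M M" "distr M M f = M" and g: "integrable M g"
    and pos: "AE a in M. \<exists>n. birkhoff_sum f g n a > 0"
  shows "0 \<le> (\<integral>a. g a \<partial>M)"
proof -
  let ?F = "max_birkhoff f g"
  \<comment> \<open>The index \<open>Suc n\<close> makes the recursion available: on
    \<open>E n\<close> the outer \<open>max\<close> with 0 is inactive.\<close>
  define E where "E n = {a \<in> space M. ?F (Suc n) a > 0}" for n
  have F: "integrable M (?F n)" for n using integrable_max_birkhoff f g .
  note [measurable] = borel_measurable_integrable[OF F] borel_measurable_integrable[OF g]
  have E [measurable]: "E n \<in> sets M" for n unfolding E_def by measurable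
  have nonneg: "0 \<le> (\<integral>a. indicator (E n) a * g a \<partial>M)" for n
  proof -
    note Ff = measure_preserving_integral[OF f F[of "Suc n"]]
    have "0 = (\<integral>a. ?F (Suc n) a - ?F (Suc n) (f a) \<partial>M)"
      by (simp only: Bochner_Integration.integral_diff[OF F Ff(1)] Ff(2) diff_self)
    also have "\<dots> \<le> (\<integral>a. indicator (E n) a * g a \<partial>M)"
    proof (rule integral_mono)
      show "integrable M (\<lambda>a. ?F (Suc n) a - ?F (Suc n) (f a))"
        using Ff F by (intro Bochner_Integration.integrable_diff)
      show "integrable M (\<lambda>a. indicator (E n) a * g a)"
        using integrable_real_mult_indicator[OF E g] by (simp add: mult.commute)
      fix a assume a: "a \<in> space M"
      show "?F (Suc n) a - ?F (Suc n) (f a) \<le> indicator (E n) a * g a"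
      proof (cases "a \<in> E n")
        case True
        then have "?F (Suc n) a = g a + ?F n (f a)"
          unfolding E_def by (auto simp: max_def split: if_splits)
        with True max_birkhoff_mono_Suc[of f g n "f a"] show ?thesis by simp
      next
        case False
        then have "?F (Suc n) a \<le> 0" using a unfolding E_def by (simp only: mem_Collect_eq simp_thms not_less)
        with False max_birkhoff_nonneg[of f g "Suc n" "f a"] show ?thesis by simp
      qed
    qed
    finally show ?thesis .
  qed
  \<comment> \<open>By \<open>pos\<close>, almost every point lies in all \<open>E n\<close> from
    some index on, so the cut-off functions converge to \<open>g\<close>.\<close>
  have "(\<lambda>n. \<integral>a. indicator (E n) a * g a \<partial>M) \<longlonglongrightarrow> (\<integral>a. g a \<partial>M)"
  proof (rule integral_dominated_convergence[where w = "\<lambda>a. norm (g a)"])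
    show "AE a in M. (\<lambda>n. indicator (E n) a * g a) \<longlonglongrightarrow> g a"
      using pos AE_space
    proof eventually_elim
      case (elim a)
      then obtain m where "0 < birkhoff_sum f g m a" by auto
      then have m: "0 < ?F m a" by (rule less_le_trans) (rule birkhoff_sum_le_max)
      then have "a \<in> E n" if "n \<ge> m" for n
        using less_le_trans[OF m max_birkhoff_mono[of m "Suc n" f g a]] that elim
        by (simp add: E_def del: max_birkhoff.simps)
      then have "\<forall>\<^sub>F n in sequentially. indicator (E n) a * g a = g a"
        by (intro eventually_sequentiallyI[of m]) simp
      then show ?case by (rule tendsto_eventually)
    qed
  next
    show "integrable M (\<lambda>a. norm (g a))" using g by (rule integrable_norm)
    show "AE a in M. norm (indicator (E n) a * g a) \<le> norm (g a)" for n
      by (intro AE_I2) (simp add: indicator_def)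
  qed measurable
  then show ?thesis by (rule LIMSEQ_le_const) (use nonneg in auto)
qed

text \<open>Unboundedness of \<open>S\<^sub>n g - c n\<close> is an exactly invariant condition, which makes it more
  convenient than \<open>limsup (S\<^sub>n g / n) > c\<close>.\<close>

lemma ergodic_birkhoff_bound:
  fixes \<mu> :: "'a::topological_space measure" and g :: "'a \<Rightarrow> real"
  assumes "borel_probability \<mu>" "ergodic \<mu> f" and g: "integrable \<mu> g"
    and c: "(\<integral>a. g a \<partial>\<mu>) < c"
  shows "AE a in \<mu>. \<exists>K. \<forall>n. birkhoff_sum f g n a \<le> c * real n + K"
proof -
  interpret prob_space \<mu> using assms by (simp add: borel_probability_def)
  have sets: "sets \<mu> = sets borel" using assms by (simp add: borel_probability_def)
  have space: "space \<mu> = UNIV" using sets_eq_imp_space_eq[OF sets] by simp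
  have f [measurable]: "f \<in> measurable \<mu> \<mu>" and fd: "distr \<mu> \<mu> f = \<mu>"
    using assms by (auto simp: ergodic_def)
  have [measurable]: "g \<in> borel_measurable \<mu>" using g by auto
  \<comment> \<open>Subtracting \<open>c\<close> makes the integral negative, so the maximal
    inequality will exclude a set of full measure.\<close>
  let ?g = "\<lambda>a. g a - c"
  define \<Gamma> where "\<Gamma> = {a. \<forall>K::nat. \<exists>n. real K < birkhoff_sum f ?g n a}"
  have "{a \<in> space \<mu>. \<forall>K::nat. \<exists>n. real K < birkhoff_sum f ?g n a} \<in> sets \<mu>"
    by measurable
  then have \<Gamma>: "\<Gamma> \<in> sets \<mu>" by (simp add: \<Gamma>_def space)
  \<comment> \<open>The sums at \<open>a\<close> and at \<open>f a\<close> differ by the fixed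
    number \<open>?g a\<close> and an index shift; a threshold \<open>L\<close> that absorbs this
    number carries unboundedness both ways.\<close>
  have "f a \<in> \<Gamma> \<longleftrightarrow> a \<in> \<Gamma>" for a
  proof
    assume fa: "f a \<in> \<Gamma>"
    show "a \<in> \<Gamma>" unfolding \<Gamma>_def
    proof safe
      fix K :: nat
      obtain L :: nat where L: "real K - ?g a \<le> real L" using real_arch_simple by blast
      obtain n where "real L < birkhoff_sum f ?g n (f a)" using fa unfolding \<Gamma>_def by blast
      with L have "real K < birkhoff_sum f ?g (Suc n) a" by (simp add: birkhoff_sum_Suc)
      then show "\<exists>n. real K < birkhoff_sum f ?g n a" by blast
    qed
  next
    assume a: "a \<in> \<Gamma>"
    show "f a \<in> \<Gamma>" unfolding \<Gamma>_def
    proof safe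
      fix K :: nat
      obtain L :: nat where L: "real K + ?g a \<le> real L" using real_arch_simple by blast
      obtain n where n: "real L < birkhoff_sum f ?g n a" using a unfolding \<Gamma>_def by blast
      \<comment> \<open>The empty sum is 0 and cannot exceed \<open>real L\<close>, so there is a
        first term to remove.\<close>
      then obtain m where "n = Suc m" by (cases n) (auto simp: birkhoff_sum_def)
      with n L have "real K < birkhoff_sum f ?g m (f a)" by (simp add: birkhoff_sum_Suc)
      then show "\<exists>n. real K < birkhoff_sum f ?g n (f a)" by blast
    qed
  qed
  then have "emeasure \<mu> \<Gamma> = 0 \<or> emeasure \<mu> \<Gamma> = 1"
    using assms(2) \<Gamma> sets unfolding ergodic_def by blast
  moreover have "emeasure \<mu> \<Gamma> \<noteq> 1"
  proof
    assume "emeasure \<mu> \<Gamma> = 1"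
    then have "AE a in \<mu>. a \<in> \<Gamma>" using \<Gamma> by (simp add: AE_in_set_eq_1 measure_def)
    then have "AE a in \<mu>. \<exists>n. birkhoff_sum f ?g n a > 0"
      by eventually_elim (force simp: \<Gamma>_def dest: spec[of _ 0])
    then have "0 \<le> (\<integral>a. ?g a \<partial>\<mu>)"
      using g by (intro maximal_ergodic[OF f fd]) auto
    also have "\<dots> = (\<integral>a. g a \<partial>\<mu>) - c"
      using g by (simp add: prob_space)
    finally show False using c by simp
  qed
  ultimately have "\<Gamma> \<in> null_sets \<mu>" using \<Gamma> by auto
  then have "AE a in \<mu>. a \<notin> \<Gamma>" by (rule AE_not_in)
  then show ?thesis
  proof eventually_elim
    case (elim a)
    then obtain K :: nat where "\<forall>n. birkhoff_sum f ?g n a \<le> real K"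
      unfolding \<Gamma>_def by (auto simp: not_less)
    then have "\<forall>n. birkhoff_sum f g n a \<le> c * real n + real K"
      by (simp add: birkhoff_sum_diff_const algebra_simps)
    then show ?case by blast
  qed
qed

text \<open>Countably many margins \<open>1 / real (Suc m)\<close> suffice, so one null set serves
  all of them; the bound only weakens as \<open>e\<close> grows.\<close>

lemma ergodic_birkhoff_subexponential:
  fixes \<mu> :: "'a::topological_space measure" and g :: "'a \<Rightarrow> real"
  assumes "borel_probability \<mu>" "ergodic \<mu> f" "integrable \<mu> g"
  shows "AE a in \<mu>. \<forall>e>0. \<exists>K. \<forall>n. birkhoff_sum f g n a \<le> ((\<integral>a. g a \<partial>\<mu>) + e) * real n + K"
proof -
  let ?I = "\<integral>a. g a \<partial>\<mu>"
  have "AE a in \<mu>. \<exists>K. \<forall>n. birkhoff_sum f g n a \<le> (?I + 1 / real (Suc m)) * real n + K" for m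
    by (rule ergodic_birkhoff_bound[OF assms]) simp
  then have "AE a in \<mu>. \<forall>m. \<exists>K. \<forall>n. birkhoff_sum f g n a \<le> (?I + 1 / real (Suc m)) * real n + K"
    by (simp add: AE_all_countable)
  then show ?thesis
  proof eventually_elim
    case (elim a)
    show ?case
    proof safe
      fix e :: real assume "e > 0"
      then obtain m where m: "1 / real (Suc m) < e" by (metis nat_approx_posE)
      obtain K where K: "\<And>n. birkhoff_sum f g n a \<le> (?I + 1 / real (Suc m)) * real n + K"
        using elim by blast
      have "birkhoff_sum f g n a \<le> (?I + e) * real n + K" for n
      proof -
        have "(?I + 1 / real (Suc m)) * real n \<le> (?I + e) * real n"
          using m by (intro mult_right_mono) auto
        then show ?thesis using K[of n] by linarith
      qed
      then show "\<exists>K. \<forall>n. birkhoff_sum f g n a \<le> (?I + e) * real n + K" by blast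
    qed
  qed
qed

section \<open>The multiplicative cocycle\<close>

definition cocycle :: "('a \<Rightarrow> 'a) \<Rightarrow> ('a \<Rightarrow> complex) \<Rightarrow> nat \<Rightarrow> 'a \<Rightarrow> complex" where
  "cocycle f h n a = (\<Prod>j<n. h ((f ^^ j) a))"

lemma cmod_cocycle:
  assumes "\<And>j. h ((f ^^ j) a) \<noteq> 0"
  shows "cmod (cocycle f h n a) = exp (birkhoff_sum f (\<lambda>a. ln (cmod (h a))) n a)"
  using assms by (simp add: cocycle_def birkhoff_sum_def exp_sum prod_norm)

lemma AE_orbit_nonzero:
  assumes f [measurable]: "f \<in> measurable M M" and "distr M M f = M"
    and [measurable]: "h \<in> borel_measurable M" and nz: "AE a in M. h a \<noteq> (0::complex)"
  shows "AE a in M. \<forall>j. h ((f ^^ j) a) \<noteq> 0"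
  unfolding AE_all_countable
proof
  fix j
  show "AE a in M. h ((f ^^ j) a) \<noteq> 0"
  proof (induction j)
    case 0
    then show ?case using nz by simp
  next
    case (Suc j)
    \<comment> \<open>Reading \<open>M\<close> as its image under \<open>f\<close> transfers the
      property from \<open>a\<close> to \<open>f a\<close>.\<close>
    then have "AE a in distr M M f. h ((f ^^ j) a) \<noteq> 0" by (simp only: assms(2))
    then have "AE a in M. h ((f ^^ j) (f a)) \<noteq> 0"
      by (subst (asm) AE_distr_iff) auto
    then show ?case by (simp add: funpow_swap1)
  qed
qed

text \<open>For a nonvanishing cocycle the two bounds together say that
  \<open>ln (cmod (cocycle f h n a)) / n\<close> tends to \<gamma>. Nonvanishing is a clause of its
  own because \<open>inverse 0 = 0\<close> would pass the second bound.\<close>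

definition log_generic :: "('a \<Rightarrow> 'a) \<Rightarrow> ('a \<Rightarrow> complex) \<Rightarrow> real \<Rightarrow> 'a \<Rightarrow> bool" where
  "log_generic f h \<gamma> a \<longleftrightarrow>
     (\<forall>e>0. \<exists>C. \<forall>n. cmod (cocycle f h n a) \<le> C * exp ((\<gamma> + e) * real n)) \<and>
     (\<forall>e>0. \<exists>C. \<forall>n. inverse (cmod (cocycle f h n a)) \<le> C * exp ((- \<gamma> + e) * real n)) \<and>
     (\<forall>n. cocycle f h n a \<noteq> 0)"

text \<open>The one-sided Birkhoff bound is applied to \<open>ln (cmod (h a))\<close> and to its
  negative; exponentiating turns the additive constant \<open>K\<close> into the factor
  \<open>C\<close>.\<close>

lemma AE_log_generic:
  fixes \<mu> :: "'a::topological_space measure"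
  assumes \<mu>: "borel_probability \<mu>" "ergodic \<mu> f" and h: "continuous_on UNIV h"
    and fin: "finite_log_integral \<mu> h"
  shows "AE a in \<mu>. log_generic f h (\<integral>a. ln (cmod (h a)) \<partial>\<mu>) a"
proof -
  let ?\<gamma> = "\<integral>a. ln (cmod (h a)) \<partial>\<mu>" and ?l = "\<lambda>a. ln (cmod (h a))"
  have int: "integrable \<mu> ?l" "AE a in \<mu>. h a \<noteq> 0" using fin by (auto simp: finite_log_integral_def)
  have "sets \<mu> = sets borel" using \<mu> by (simp add: borel_probability_def)
  then have hm: "h \<in> borel_measurable \<mu>"
    using borel_measurable_continuous_onI[OF h] measurable_cong_sets by blast
  have f: "f \<in> measurable \<mu> \<mu>" "distr \<mu> \<mu> f = \<mu>" using \<mu> by (auto simp: ergodic_def)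
  have upper: "AE a in \<mu>. \<forall>e>0. \<exists>K. \<forall>n. birkhoff_sum f ?l n a \<le> (?\<gamma> + e) * real n + K"
    by (rule ergodic_birkhoff_subexponential[OF \<mu> int(1)])
  have lower: "AE a in \<mu>. \<forall>e>0. \<exists>K. \<forall>n. - birkhoff_sum f ?l n a \<le> (- ?\<gamma> + e) * real n + K"
    using ergodic_birkhoff_subexponential[OF \<mu> integrable_minus[OF int(1)]]
    by (simp add: birkhoff_sum_uminus)
  show ?thesis using upper lower AE_orbit_nonzero[OF f hm int(2)]
  proof eventually_elim
    case (elim a)
    then have nz: "h ((f ^^ j) a) \<noteq> 0" for j by blast
    have exp_bound: "\<exists>C. \<forall>n. exp (s n) \<le> C * exp (c * real n)"
      if bound: "\<exists>K. \<forall>n. s n \<le> c * real n + K" for s :: "nat \<Rightarrow> real" and c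
    proof -
      obtain K where "\<And>n. s n \<le> c * real n + K" using bound by blast
      then have "exp (s n) \<le> exp K * exp (c * real n)" for n
        by (simp add: exp_add [symmetric] add.commute)
      then show ?thesis by blast
    qed
    show ?case unfolding log_generic_def cmod_cocycle[of h f a, OF nz] exp_minus [symmetric]
    proof (intro conjI allI impI)
      fix e :: real assume "e > 0"
      then show "\<exists>C. \<forall>n. exp (birkhoff_sum f ?l n a) \<le> C * exp ((?\<gamma> + e) * real n)"
        and "\<exists>C. \<forall>n. exp (- birkhoff_sum f ?l n a) \<le> C * exp ((- ?\<gamma> + e) * real n)"
        using elim by (intro exp_bound; blast)+
    next
      show "cocycle f h n a \<noteq> 0" for n using nz by (simp add: cocycle_def)
    qed
  qed
qed

section \<open>Generic pairs in a set of positive measure\<close>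

text \<open>Pairs with a bad coordinate lie in the union of two null strips
  \<open>A \<times> space N\<close> and \<open>space M \<times> B\<close>, which cannot contain a
  set of positive measure.\<close>

lemma completion_pair_positive_imp_ex:
  assumes "sigma_finite_measure N" and R: "AE a in M. R a" and Q: "AE b in N. Q b"
    and pos: "emeasure (completion (M \<Otimes>\<^sub>M N)) Z > 0"
  shows "\<exists>(a, b)\<in>Z. R a \<and> Q b"
proof (rule ccontr)
  assume no: "\<not> (\<exists>(a, b)\<in>Z. R a \<and> Q b)"
  interpret sigma_finite_measure N by fact
  obtain A where A: "{a \<in> space M. \<not> R a} \<subseteq> A" "A \<in> null_sets M"
    using R by (auto elim!: AE_E simp: null_sets_def)
  obtain B where B: "{b \<in> space N. \<not> Q b} \<subseteq> B" "B \<in> null_sets N"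
    using Q by (auto elim!: AE_E simp: null_sets_def)
  have "A \<times> space N \<in> null_sets (M \<Otimes>\<^sub>M N)" "space M \<times> B \<in> null_sets (M \<Otimes>\<^sub>M N)"
    using A B by (auto simp: null_sets_def emeasure_pair_measure_Times)
  then have null: "A \<times> space N \<union> space M \<times> B \<in> null_sets (completion (M \<Otimes>\<^sub>M N))"
    by (auto intro: null_sets_completionI null_sets.Un)
  \<comment> \<open>A nonmeasurable set has \<open>emeasure\<close> 0 by convention, so positivity
    gives measurability.\<close>
  have "Z \<in> sets (completion (M \<Otimes>\<^sub>M N))"
    using pos emeasure_notin_sets by fastforce
  then have "Z \<subseteq> space M \<times> space N"
    using sets.sets_into_space by (fastforce simp: space_pair_measure)
  then have "Z \<subseteq> A \<times> space N \<union> space M \<times> B" using no A(1) B(1) by blast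
  then have "emeasure (completion (M \<Otimes>\<^sub>M N)) Z = 0"
    using null by (metis emeasure_mono le_zero_eq null_setsD1 null_setsD2)
  then show False using pos by simp
qed

section \<open>Iterates of the skew product\<close>

lemma bounded_clinear_scaleC:
  fixes T :: "'x::complex_normed_vector \<Rightarrow> 'x"
  shows "bounded_clinear T \<Longrightarrow> T (c *\<^sub>C x) = c *\<^sub>C T x"
  by (auto simp: bounded_clinear_def Vector_Spaces.linear_iff)

lemma bounded_clinear_imp_bounded_linear:
  fixes T :: "'x::complex_normed_vector \<Rightarrow> 'x"
  assumes T: "bounded_clinear T"
  shows "bounded_linear T"
proof -
  obtain K where "\<And>x. norm (T x) \<le> norm x * K"
    using T by (auto simp: bounded_clinear_def mult.commute)
  moreover have "T (x + y) = T x + T y" for x y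
    using T by (auto simp: bounded_clinear_def Vector_Spaces.linear_iff)
  moreover have "T (r *\<^sub>R x) = r *\<^sub>R T x" for r x
    using bounded_clinear_scaleC[OF T, of "complex_of_real r" x] by (simp add: scaleC_of_real)
  ultimately show ?thesis by (intro bounded_linear_intro)
qed

lemma bounded_clinear_funpow_scaleC:
  fixes T :: "'x::complex_normed_vector \<Rightarrow> 'x"
  shows "bounded_clinear T \<Longrightarrow> (T ^^ n) (c *\<^sub>C x) = c *\<^sub>C (T ^^ n) x"
  by (induction n) (auto simp: bounded_clinear_scaleC)

lemma bounded_linear_funpow:
  fixes T :: "'x::real_normed_vector \<Rightarrow> 'x"
  shows "bounded_linear T \<Longrightarrow> bounded_linear (T ^^ n)"
proof (induction n)
  case 0
  then show ?case by (simp add: id_def bounded_linear_ident)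
next
  case (Suc n)
  then show ?case by (auto simp: o_def intro: bounded_linear_compose)
qed

lemma skew_product_funpow:
  fixes T :: "'x::complex_normed_vector \<Rightarrow> 'x"
  assumes T: "bounded_clinear T"
  shows "(skew_product f h T ^^ n) (a, x) = ((f ^^ n) a, cocycle f h n a *\<^sub>C (T ^^ n) x)"
proof (induction n)
  case 0
  then show ?case by (simp add: cocycle_def scaleC_one)
next
  case (Suc n)
  then show ?case
    by (simp add: skew_product_def cocycle_def bounded_clinear_scaleC[OF T] scaleC_scaleC mult.commute)
qed

section \<open>Return times and growth rates\<close>

lemma infinite_UNIV_perfect_space: "infinite (UNIV :: 'a::{t1_space, perfect_space} set)"
proof
  assume "finite (UNIV :: 'a set)"
  then have "closed (- {undefined :: 'a})" by (intro finite_imp_closed) (rule finite_subset, auto)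
  then have "open {undefined :: 'a}" by (simp add: closed_def)
  then show False using not_open_singleton by blast
qed

text \<open>Deleting the base points visited up to time \<open>N\<close> leaves a nonempty open set,
  since the base is infinite. The dense orbit meets this set times \<open>V\<close>, necessarily
  after time \<open>N\<close>.\<close>

lemma Trans_visits_large_times:
  fixes F :: "'a::{t1_space, perfect_space} \<times> 'b::topological_space \<Rightarrow> 'a \<times> 'b"
  assumes p: "p \<in> Trans F" and V: "open V" "V \<noteq> {}"
  shows "\<exists>n>N. snd ((F ^^ n) p) \<in> V"
proof -
  define A where "A = (\<lambda>n. fst ((F ^^ n) p)) ` {..N}"
  have "A \<noteq> UNIV" using infinite_UNIV_perfect_space unfolding A_def by (metis finite_atMost finite_imageI)
  moreover have "open (- A)" unfolding A_def by (intro open_Compl finite_imp_closed) auto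
  moreover define W where "W = (- A) \<times> V"
  ultimately have "open W" "W \<noteq> {}" using V by (auto intro: open_Times)
  moreover have "closure (range (\<lambda>n. (F ^^ n) p)) = UNIV" using p by (simp add: Trans_def)
  ultimately have "range (\<lambda>n. (F ^^ n) p) \<inter> W \<noteq> {}"
    by (metis Int_UNIV_right inf_commute open_Int_closure_eq_empty)
  then obtain n where n: "(F ^^ n) p \<in> W" by blast
  then have "n \<notin> {..N}" unfolding A_def W_def by (metis ComplD imageI mem_Times_iff)
  moreover have "snd ((F ^^ n) p) \<in> V" using n unfolding W_def by (metis mem_Times_iff)
  ultimately show ?thesis by (intro exI[of _ n]) simp
qed

lemma limsup_root_le_exp:
  fixes v :: "nat \<Rightarrow> real"
  assumes n: "strict_mono n" "\<And>k. n k > 0"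
    and v: "\<And>e. e > 0 \<Longrightarrow> \<exists>C. \<forall>k. v k \<le> C * exp ((g + e) * real (n k))"
  shows "limsup (\<lambda>k. ereal (root (n k) (v k))) \<le> ereal (exp g)"
proof -
  have le: "limsup (\<lambda>k. ereal (root (n k) (v k))) \<le> ereal (exp (g + e))" if e: "e > 0" for e
  proof -
    obtain C0 where C0: "\<And>k. v k \<le> C0 * exp ((g + e) * real (n k))" using v[OF e] by blast
    \<comment> \<open>A positive constant is needed for its roots to tend to 1.\<close>
    define C where "C = max C0 1"
    have C: "C > 0" by (simp add: C_def)
    have "root (n k) (v k) \<le> root (n k) C * exp (g + e)" for k
    proof -
      have "v k \<le> C * exp (g + e) ^ n k"
      proof -
        have "C0 * exp ((g + e) * real (n k)) \<le> C * exp ((g + e) * real (n k))"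
          by (intro mult_right_mono) (auto simp: C_def)
        with C0[of k] show ?thesis unfolding exp_of_nat2_mult by linarith
      qed
      then have "root (n k) (v k) \<le> root (n k) (C * exp (g + e) ^ n k)"
        using n(2) by simp
      also have "\<dots> = root (n k) C * exp (g + e)"
        using n(2) by (simp add: real_root_mult real_root_power_cancel)
      finally show ?thesis .
    qed
    then have "limsup (\<lambda>k. ereal (root (n k) (v k))) \<le> limsup (\<lambda>k. ereal (root (n k) C * exp (g + e)))"
      by (intro Limsup_mono) auto
    also have "\<dots> = ereal (exp (g + e))"
    proof (rule lim_imp_Limsup)
      have "(\<lambda>k. root (n k) C) \<longlonglongrightarrow> 1"
        using LIMSEQ_subseq_LIMSEQ[OF LIMSEQ_root_const[OF C] n(1)] by (simp add: o_def)
      then have "(\<lambda>k. root (n k) C * exp (g + e)) \<longlonglongrightarrow> 1 * exp (g + e)"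
        by (intro tendsto_intros)
      then show "(\<lambda>k. ereal (root (n k) C * exp (g + e))) \<longlonglongrightarrow> ereal (exp (g + e))" by simp
    qed simp
    finally show ?thesis .
  qed
  \<comment> \<open>The bound holds for every positive \<open>e\<close>; now \<open>e\<close> tends
    to 0 from the right.\<close>
  have "((\<lambda>e. ereal (exp (g + e))) \<longlongrightarrow> ereal (exp (g + 0))) (at_right 0)"
    by (intro tendsto_intros)
  then have "((\<lambda>e. ereal (exp (g + e))) \<longlongrightarrow> ereal (exp g)) (at_right 0)" by simp
  moreover have "\<forall>\<^sub>F e in at_right 0. limsup (\<lambda>k. ereal (root (n k) (v k))) \<le> ereal (exp (g + e))"
    using le by (auto simp: eventually_at_right_field intro: exI[of _ 1])
  ultimately show ?thesis by (rule tendsto_lowerbound) simp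
qed

text \<open>The orbit is made to enter the unit ball in the first fibre and ever smaller balls
  around \<open>x\<close> in the second. Such times exist beyond any bound, so they can be chosen
  increasing.\<close>

lemma Trans_skew_product_times:
  fixes T :: "'x::complex_normed_vector \<Rightarrow> 'x" and f :: "'a::{t1_space, perfect_space} \<Rightarrow> 'a"
  assumes T: "bounded_clinear T"
    and tr: "((a, x), (b, y)) \<in> Trans (map_prod (skew_product f h T) (skew_product f h T))"
  shows "\<exists>n. strict_mono n \<and> (\<forall>k. n k > 0) \<and>
    (\<forall>k. norm (cocycle f h (n k) a *\<^sub>C (T ^^ n k) x) < 1) \<and>
    (\<lambda>k. (T ^^ n k) (cocycle f h (n k) b *\<^sub>C y)) \<longlonglongrightarrow> x"
proof -
  let ?P = "skew_product f h T"
  \<comment> \<open>The radius 1 is arbitrary: only boundedness matters for the exponential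
    rate.\<close>
  define good where "good k n \<longleftrightarrow> norm (cocycle f h n a *\<^sub>C (T ^^ n) x) < 1 \<and>
    dist ((T ^^ n) (cocycle f h n b *\<^sub>C y)) x < 1 / real (Suc k)" for k n
  \<comment> \<open>The orbit in \<open>(A \<times> X) \<times> (A \<times> X)\<close> is reread in \<open>A \<times> (X \<times> (A \<times> X))\<close>, so that the leading
    factor without isolated points forces large return times.\<close>
  define swap where "swap = (\<lambda>((a, x), q). (a, x, q) :: 'a \<times> 'x \<times> 'a \<times> 'x)"
  define F where "F = (\<lambda>(a, x, q). swap (map_prod ?P ?P ((a, x), q)))"
  have F: "(F ^^ n) (swap p) = swap ((map_prod ?P ?P ^^ n) p)" for n p
  proof (induction n)
    case (Suc n)
    then show ?case by (cases "(map_prod ?P ?P ^^ n) p") (auto simp: F_def swap_def)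
  qed simp
  have orbit: "(map_prod ?P ?P ^^ n) ((a, x), (b, y)) = ((?P ^^ n) (a, x), (?P ^^ n) (b, y))" for n
    by (induction n) auto
  \<comment> \<open>A continuous surjection carries a dense orbit to a dense set.\<close>
  have "closure (range (\<lambda>n. (F ^^ n) (swap ((a, x), (b, y))))) = UNIV"
  proof -
    let ?R = "range (\<lambda>n. (map_prod ?P ?P ^^ n) ((a, x), (b, y)))"
    have "continuous_on (closure ?R) swap"
      unfolding swap_def case_prod_beta by (intro continuous_intros)
    then have "swap ` closure ?R \<subseteq> closure (swap ` ?R)"
      by (intro image_closure_subset closure_subset) auto
    moreover have "closure ?R = UNIV" using tr by (simp add: Trans_def)
    moreover have "surj swap" unfolding swap_def by (rule surjI[of _ "\<lambda>(a, x, q). ((a, x), q)"]) auto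
    moreover have "range (\<lambda>n. (F ^^ n) (swap ((a, x), (b, y)))) = swap ` ?R"
      by (simp only: F image_image)
    ultimately show ?thesis by (metis top.extremum_unique)
  qed
  then have swap_tr: "swap ((a, x), (b, y)) \<in> Trans F" by (simp add: Trans_def)
  have ex: "\<exists>n>N. good k n" for k N
  proof -
    have "open (ball 0 1 \<times> (UNIV :: 'a set) \<times> ball x (1 / real (Suc k)))" by (intro open_Times) auto
    moreover have "(0, undefined, x) \<in> ball (0::'x) 1 \<times> (UNIV :: 'a set) \<times> ball x (1 / real (Suc k))"
      by simp
    then have "ball (0::'x) 1 \<times> (UNIV :: 'a set) \<times> ball x (1 / real (Suc k)) \<noteq> {}" by blast
    ultimately obtain n where n: "n > N"
      "snd ((F ^^ n) (swap ((a, x), (b, y)))) \<in> ball 0 1 \<times> UNIV \<times> ball x (1 / real (Suc k))"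
      using Trans_visits_large_times[OF swap_tr] by metis
    then have "good k n"
      unfolding F orbit skew_product_funpow[OF T]
      by (simp add: swap_def good_def dist_commute bounded_clinear_funpow_scaleC[OF T])
    with n show ?thesis by blast
  qed
  obtain n where n0: "n 0 > 0" and good: "\<And>k. good k (n k)" and inc: "\<And>k. n k < n (Suc k)"
  proof -
    have "\<exists>n. \<forall>k. (0 < n k \<and> good k (n k)) \<and> n k < n (Suc k)"
    proof (rule dependent_nat_choice)
      show "\<exists>n. 0 < n \<and> good 0 n" using ex[of 0 0] by simp
      show "\<exists>m. (0 < m \<and> good (Suc k) m) \<and> n < m" if "0 < n \<and> good k n" for n k
      proof -
        obtain m where "n < m" "good (Suc k) m" using ex by metis
        then show ?thesis by (intro exI[of _ m]) simp
      qed
    qed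
    then show ?thesis using that by blast
  qed
  have mono: "strict_mono n" using inc by (simp add: strict_mono_Suc_iff)
  moreover have "n k > 0" for k using n0 strict_mono_less_eq[OF mono, of 0 k] by simp
  moreover have "(\<lambda>k. (T ^^ n k) (cocycle f h (n k) b *\<^sub>C y)) \<longlonglongrightarrow> x"
  proof (rule metric_LIMSEQ_I)
    fix r :: real assume "r > 0"
    then obtain K where K: "1 / real (Suc K) < r" by (metis nat_approx_posE)
    have "dist ((T ^^ n k) (cocycle f h (n k) b *\<^sub>C y)) x < r" if "k \<ge> K" for k
    proof -
      have "1 / real (Suc k) \<le> 1 / real (Suc K)" using that by (simp add: divide_simps)
      then show ?thesis using good[of k] K unfolding good_def by linarith
    qed
    then show "\<exists>K. \<forall>k\<ge>K. dist ((T ^^ n k) (cocycle f h (n k) b *\<^sub>C y)) x < r" by blast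
  qed
  moreover have "norm (cocycle f h (n k) a *\<^sub>C (T ^^ n k) x) < 1" for k
    using good[of k] by (simp only: good_def)
  ultimately show ?thesis by (intro exI[of _ n]) simp
qed

text \<open>Projection to the first fibre is continuous and onto, so the image of the dense orbit is
  dense.\<close>

lemma Trans_skew_product_dense:
  fixes T :: "'x::complex_normed_vector \<Rightarrow> 'x" and f :: "'a::topological_space \<Rightarrow> 'a"
  assumes T: "bounded_clinear T"
    and tr: "((a, x), (b, y)) \<in> Trans (map_prod (skew_product f h T) (skew_product f h T))"
  shows "closure (range (\<lambda>m. cocycle f h m a *\<^sub>C (T ^^ m) x)) = UNIV"
proof -
  let ?P = "skew_product f h T"
  let ?R = "range (\<lambda>n. (map_prod ?P ?P ^^ n) ((a, x), (b, y)))"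
  let ?\<pi> = "\<lambda>p :: ('a \<times> 'x) \<times> 'a \<times> 'x. snd (fst p)"
  have orbit: "(map_prod ?P ?P ^^ n) ((a, x), (b, y)) = ((?P ^^ n) (a, x), (?P ^^ n) (b, y))" for n
    by (induction n) auto
  have "continuous_on (closure ?R) ?\<pi>" by (intro continuous_intros)
  then have "?\<pi> ` closure ?R \<subseteq> closure (?\<pi> ` ?R)"
    by (intro image_closure_subset closure_subset) auto
  moreover have "surj ?\<pi>" by (rule surjI[of _ "\<lambda>x. ((a, x), (b, y))"]) simp
  ultimately show ?thesis
    using tr by (auto simp: Trans_def orbit image_image skew_product_funpow[OF T])
qed

section \<open>The dense set and the approximate right inverses\<close>

theorem theorem4p10:
  fixes f :: "'a::{metric_space, perfect_space} \<Rightarrow> 'a"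
    and \<mu> :: "'a measure"
    and h :: "'a \<Rightarrow> complex"
    and \<gamma> :: real
    and T :: "'x::complex_banach \<Rightarrow> 'x"
    and P :: "'a \<times> 'x \<Rightarrow> 'a \<times> 'x"
  assumes "compact (UNIV :: 'a set)"
    and "continuous_on UNIV f"
    and "borel_probability \<mu>" and "full_support \<mu>" and "ergodic \<mu> f"
    and "continuous_on UNIV h"
    and "finite_log_integral \<mu> h" and "\<gamma> = (\<integral>a. ln (cmod (h a)) \<partial>\<mu>)"
    and "infinite_dimensional TYPE('x)"
    and "separable_space (euclidean :: 'x topology)"
    and "bounded_clinear T"
    and "P = skew_product f h T"
    and "topologically_weakly_mixing P"
    and "emeasure (completion (\<mu> \<Otimes>\<^sub>M \<mu>)) (transitive_base P) > 0"
  shows "\<exists>(n :: nat \<Rightarrow> nat) (D1 :: 'x set) (D2 :: 'x set) (S :: nat \<Rightarrow> 'x \<Rightarrow> 'x).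
           strict_mono n \<and> (\<forall>k. n k > 0) \<and> closure D1 = UNIV \<and> closure D2 = UNIV \<and>
           (\<forall>x\<in>D1. limsup (\<lambda>k. ereal (root (n k) (norm ((T ^^ n k) x)))) \<le> ereal (exp (- \<gamma>))) \<and>
           (\<forall>y\<in>D2. limsup (\<lambda>k. ereal (root (n k) (norm (S (n k) y)))) \<le> ereal (exp \<gamma>)) \<and>
           (\<forall>y\<in>D2. (\<lambda>k. norm ((T ^^ n k) (S (n k) y) - y)) \<longlonglongrightarrow> 0)"
proof -
  note T = \<open>bounded_clinear T\<close>
  interpret prob_space \<mu> using assms(3) by (simp add: borel_probability_def)
  have "AE a in \<mu>. log_generic f h \<gamma> a" using AE_log_generic[OF assms(3,5,6,7)] assms(8) by simp
  from completion_pair_positive_imp_ex[OF sigma_finite_measure_axioms this this assms(14)]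
  obtain a b x y where a: "log_generic f h \<gamma> a" and b: "log_generic f h \<gamma> b"
    and "((a, x), (b, y)) \<in> Trans (map_prod P P)"
    by (auto simp: transitive_base_def)
  then have tr: "((a, x), (b, y)) \<in> Trans (map_prod (skew_product f h T) (skew_product f h T))"
    by (simp add: assms(12))
  obtain n where n: "strict_mono n" "\<And>k. n k > 0"
    and small: "\<And>k. norm (cocycle f h (n k) a *\<^sub>C (T ^^ n k) x) < 1"
    and lim: "(\<lambda>k. (T ^^ n k) (cocycle f h (n k) b *\<^sub>C y)) \<longlonglongrightarrow> x"
    using Trans_skew_product_times[OF T tr] by blast
  \<comment> \<open>\<open>L m\<close> is bounded and commutes with the powers of \<open>T\<close>,
    so everything known about \<open>x\<close> and \<open>y\<close> carries over to the whole set
    \<open>D\<close>.\<close>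
  define L where "L m v = cocycle f h m a *\<^sub>C (T ^^ m) v" for m v
  define D where "D = range (\<lambda>m. L m x)"
  \<comment> \<open>A vector may equal \<open>L m x\<close> for several \<open>m\<close>; the choice
    fixes one that depends on \<open>z\<close> only and not on \<open>j\<close>.\<close>
  define S where "S j z = L (SOME m. z = L m x) (cocycle f h j b *\<^sub>C y)" for j z
  have L: "bounded_linear (L m)" for m
  proof -
    have "bounded_linear (\<lambda>v :: 'x. cocycle f h m a *\<^sub>C v)"
      by (rule bounded_linear_intro[where K = "cmod (cocycle f h m a)"])
        (simp_all add: scaleC_add_right norm_scaleC scaleC_scaleC scaleC_of_real [symmetric] mult.commute)
    from bounded_linear_compose[OF this
        bounded_linear_funpow[OF bounded_clinear_imp_bounded_linear[OF T]]]
    show ?thesis unfolding L_def .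
  qed
  have TL: "(T ^^ j) (L m v) = L m ((T ^^ j) v)" for j m v
  proof -
    have "(T ^^ j) ((T ^^ m) v) = (T ^^ m) ((T ^^ j) v)"
      by (metis add.commute comp_apply funpow_add)
    then show ?thesis by (simp add: L_def bounded_clinear_funpow_scaleC[OF T])
  qed
  have S: "\<exists>m. z = L m x \<and> (\<forall>j. S j z = L m (cocycle f h j b *\<^sub>C y))" if "z \<in> D" for z
  proof -
    have "\<exists>m. z = L m x" using that by (auto simp: D_def)
    then have "z = L (SOME m. z = L m x) x" by (rule someI_ex)
    then show ?thesis unfolding S_def by blast
  qed
  \<comment> \<open>Applying \<open>L m\<close> costs only a constant factor, which disappears under
    the roots.\<close>
  have root_L: "limsup (\<lambda>k. ereal (root (n k) (norm (L m (v k))))) \<le> ereal (exp g)"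
    if v: "\<And>e. e > 0 \<Longrightarrow> \<exists>C. \<forall>k. norm (v k) \<le> C * exp ((g + e) * real (n k))" for m v g
  proof (rule limsup_root_le_exp[OF n])
    fix e :: real assume "e > 0"
    then obtain C where C: "\<And>k. norm (v k) \<le> C * exp ((g + e) * real (n k))" using v by blast
    obtain K where K: "K > 0" "\<And>w. norm (L m w) \<le> norm w * K"
      using bounded_linear.pos_bounded[OF L] by blast
    have "norm (L m (v k)) \<le> C * K * exp ((g + e) * real (n k))" for k
      using order_trans[OF K(2)[of "v k"] mult_right_mono[OF C[of k], of K]] K(1)
      by (simp add: mult_ac)
    then show "\<exists>C. \<forall>k. norm (L m (v k)) \<le> C * exp ((g + e) * real (n k))" by blast
  qed
  have "closure D = UNIV" unfolding D_def L_def by (rule Trans_skew_product_dense[OF T tr])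
  moreover have "limsup (\<lambda>k. ereal (root (n k) (norm ((T ^^ n k) z)))) \<le> ereal (exp (- \<gamma>))"
    if z: "z \<in> D" for z
  proof -
    obtain m where m: "z = L m x" using z by (auto simp: D_def)
    show ?thesis unfolding m TL
    proof (rule root_L)
      fix e :: real assume "e > 0"
      then obtain C where
        C: "\<And>j. inverse (cmod (cocycle f h j a)) \<le> C * exp ((- \<gamma> + e) * real j)"
        using a unfolding log_generic_def by blast
      have "norm ((T ^^ n k) x) \<le> C * exp ((- \<gamma> + e) * real (n k))" for k
      proof -
        have "cocycle f h (n k) a \<noteq> 0" using a unfolding log_generic_def by blast
        \<comment> \<open>Dividing the unit bound by the nonzero cocycle leaves its inverse, which
          grows at rate at most \<open>- \<gamma>\<close>.\<close>
        then have "norm ((T ^^ n k) x) \<le> inverse (cmod (cocycle f h (n k) a))"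
          using small[of k] by (simp add: norm_scaleC field_simps)
        also note C
        finally show ?thesis .
      qed
      then show "\<exists>C. \<forall>k. norm ((T ^^ n k) x) \<le> C * exp ((- \<gamma> + e) * real (n k))" by blast
    qed
  qed
  moreover have "limsup (\<lambda>k. ereal (root (n k) (norm (S (n k) z)))) \<le> ereal (exp \<gamma>)"
    if z: "z \<in> D" for z
  proof -
    obtain m where m: "\<And>j. S j z = L m (cocycle f h j b *\<^sub>C y)" using S[OF z] by blast
    show ?thesis unfolding m
    proof (rule root_L)
      fix e :: real assume "e > 0"
      then obtain C where C: "\<And>j. cmod (cocycle f h j b) \<le> C * exp ((\<gamma> + e) * real j)"
        using b unfolding log_generic_def by blast
      have "norm (cocycle f h (n k) b *\<^sub>C y) \<le> C * norm y * exp ((\<gamma> + e) * real (n k))" for k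
        using mult_right_mono[OF C[of "n k"], of "norm y"] by (simp add: norm_scaleC mult_ac)
      then show "\<exists>C. \<forall>k. norm (cocycle f h (n k) b *\<^sub>C y) \<le> C * exp ((\<gamma> + e) * real (n k))"
        by blast
    qed
  qed
  moreover have "(\<lambda>k. norm ((T ^^ n k) (S (n k) z) - z)) \<longlonglongrightarrow> 0" if z: "z \<in> D" for z
  proof -
    obtain m where m: "z = L m x" "\<And>j. S j z = L m (cocycle f h j b *\<^sub>C y)" using S[OF z] by blast
    \<comment> \<open>Commuting \<open>T ^^ n k\<close> past \<open>L m\<close> reduces this to
      \<open>lim\<close>, and continuity of \<open>L m\<close> gives the limit
      \<open>L m x = z\<close>.\<close>
    have "(\<lambda>k. (T ^^ n k) (S (n k) z)) \<longlonglongrightarrow> z"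
      using bounded_linear.tendsto[OF L[of m] lim] unfolding m(2) TL by (simp add: m(1))
    then show ?thesis using LIM_zero tendsto_norm_zero by blast
  qed
  ultimately show ?thesis using n
    by (intro exI[of _ n] exI[of _ D] exI[of _ S]) blast
qed

end
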